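(* Let $R$ be a commutative unitary Noetherian ring and let $M$ be a non-zero $R$-module of finite type. Equip $\operatorname{Spec}(R)$ with an arbitrary total order $\leqslant$ that extends the order of inclusion of prime ideals. Then there exists a unique sequence \[\boldsymbol{0}=M_0\subsetneq M_1\subsetneq\ldots\subsetneq M_n=M\] of sub-$R$-modules of $M$, along with a strictly decreasing sequence \[\mathfrak p_1>\ldots>\mathfrak p_n\] in $(\operatorname{Spec}(R),\leqslant)$, such that, for any $i\in\{1,\ldots,n\}$, the subquotient $R$-module $M_{i}/M_{i-1}$ is $\mathfrak p_i$-coprimary.
   Context: For an $R$-module $N$, $\operatorname{Ass}(N)$ denotes the set of associated prime ideals of $N$, i.e. the prime ideals of the form $\{a\in R\,:\,as=0\}$ with $s\in N$. For a prime ideal $\mathfrak p$, an $R$-module $N$ is $\mathfrak p$-coprimary if $\operatorname{Ass}(N)=\{\mathfrak p\}$. *)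

theory Defs
  imports "HOL-Algebra.Module" "HOL-Algebra.Ring_Divisibility"
begin

definition Spec :: "('a, 'r) ring_scheme \<Rightarrow> 'a set set"
  where "Spec R = {\<pp>. primeideal \<pp> R}"

definition annihilator ::
    "('a, 'r) ring_scheme \<Rightarrow> ('a, 'b, 'm) module_scheme \<Rightarrow> 'b \<Rightarrow> 'a set"
  where "annihilator R N s = {a \<in> carrier R. a \<odot>\<^bsub>N\<^esub> s = \<zero>\<^bsub>N\<^esub>}"

definition Ass :: "('a, 'r) ring_scheme \<Rightarrow> ('a, 'b, 'm) module_scheme \<Rightarrow> 'a set set"
  where "Ass R N = {\<pp> \<in> Spec R. \<exists>s \<in> carrier N. \<pp> = annihilator R N s}"

definition coprimary ::
    "('a, 'r) ring_scheme \<Rightarrow> 'a set \<Rightarrow> ('a, 'b, 'm) module_scheme \<Rightarrow> bool"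
  where "coprimary R \<pp> N \<longleftrightarrow> \<pp> \<in> Spec R \<and> Ass R N = {\<pp>}"

definition genmodule ::
    "('a, 'r) ring_scheme \<Rightarrow> ('a, 'b, 'm) module_scheme \<Rightarrow> 'b set \<Rightarrow> 'b set"
  where "genmodule R M S = \<Inter>{H. submodule H R M \<and> S \<subseteq> H}"

definition finite_type :: "('a, 'r) ring_scheme \<Rightarrow> ('a, 'b, 'm) module_scheme \<Rightarrow> bool"
  where "finite_type R M \<longleftrightarrow> (\<exists>S \<subseteq> carrier M. finite S \<and> carrier M = genmodule R M S)"

text \<open>The record type of modules extends that of rings, so it carries \<open>mult\<close> and \<open>one\<close> fields;
  these play no role in a module and are left undefined.\<close>

definition quotient_module :: "('a, 'b, 'm) module_scheme \<Rightarrow> 'b set \<Rightarrow> ('a, 'b set) module"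
    (infixl \<open>QuotM\<close> 65)
  where "M QuotM N =
    \<lparr>carrier = a_rcosets\<^bsub>M\<^esub> N, mult = undefined, one = undefined,
     zero = N, add = set_add M,
     smult = (\<lambda>a X. \<Union>x\<in>X. N +>\<^bsub>M\<^esub> (a \<odot>\<^bsub>M\<^esub> x))\<rparr>"

definition subquotient :: "('a, 'b, 'm) module_scheme \<Rightarrow> 'b set \<Rightarrow> 'b set \<Rightarrow> ('a, 'b set) module"
  where "subquotient M H N = (M\<lparr>carrier := H\<rparr>) QuotM N"

lemma (in module) quotient_smult_rcoset:
  assumes N: "submodule N R M" and a: "a \<in> carrier R" and x: "x \<in> carrier M"
  shows "a \<odot>\<^bsub>M QuotM N\<^esub> (N +>\<^bsub>M\<^esub> x) = N +>\<^bsub>M\<^esub> (a \<odot>\<^bsub>M\<^esub> x)"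
proof -
  have sub: "subgroup N (add_monoid M)"
    using N by (rule submodule.axioms(1))
  have NM: "N \<subseteq> carrier M" using submoduleE(1)[OF N] .
  have "N +>\<^bsub>M\<^esub> (a \<odot>\<^bsub>M\<^esub> y) = N +>\<^bsub>M\<^esub> (a \<odot>\<^bsub>M\<^esub> x)" if y: "y \<in> N +>\<^bsub>M\<^esub> x" for y
  proof -
    obtain h where h: "h \<in> N" "y = h \<oplus>\<^bsub>M\<^esub> x"
      using y by (auto simp: a_r_coset_def')
    have "a \<odot>\<^bsub>M\<^esub> y = (a \<odot>\<^bsub>M\<^esub> h) \<oplus>\<^bsub>M\<^esub> (a \<odot>\<^bsub>M\<^esub> x)"
      using h a x NM by (auto simp: smult_r_distr)
    moreover have "a \<odot>\<^bsub>M\<^esub> h \<in> N" using submoduleE(4)[OF N a h(1)] .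
    ultimately have "a \<odot>\<^bsub>M\<^esub> y \<in> N +>\<^bsub>M\<^esub> (a \<odot>\<^bsub>M\<^esub> x)"
      by (auto simp: a_r_coset_def')
    then show ?thesis
      using M.a_repr_independence'[OF _ _ sub] a x by (simp add: a_r_coset_def)
  qed
  moreover have "x \<in> N +>\<^bsub>M\<^esub> x"
    using M.add.rcos_self[OF x sub] unfolding a_r_coset_def .
  ultimately have "(\<Union>y\<in>N +>\<^bsub>M\<^esub> x. N +>\<^bsub>M\<^esub> (a \<odot>\<^bsub>M\<^esub> y)) = N +>\<^bsub>M\<^esub> (a \<odot>\<^bsub>M\<^esub> x)"
    by blast
  then show ?thesis
    by (simp add: quotient_module_def)
qed

lemma (in module) quotient_module_is_module:
  assumes N: "submodule N R M"
  shows "module R (M QuotM N)"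
proof -
  have sub: "subgroup N (add_monoid M)"
    using N by (rule submodule.axioms(1))
  interpret A: abelian_subgroup N M
    by (rule abelian_subgroupI3[OF _ M.abelian_group_axioms])
       (simp add: additive_subgroup.intro sub)
  have car: "X \<in> carrier (M QuotM N) \<longleftrightarrow> (\<exists>x\<in>carrier M. X = N +>\<^bsub>M\<^esub> x)" for X
    by (auto simp: quotient_module_def A_RCOSETS_def')
  have add: "(N +>\<^bsub>M\<^esub> x) \<oplus>\<^bsub>M QuotM N\<^esub> (N +>\<^bsub>M\<^esub> y) = N +>\<^bsub>M\<^esub> (x \<oplus>\<^bsub>M\<^esub> y)"
    if "x \<in> carrier M" "y \<in> carrier M" for x y
    using A.a_rcos_sum[OF that] by (simp add: quotient_module_def)
  have zero: "\<zero>\<^bsub>M QuotM N\<^esub> = N +>\<^bsub>M\<^esub> \<zero>\<^bsub>M\<^esub>"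
    using A.a_subset by (simp add: quotient_module_def M.a_coset_add_zero)
  have carI: "N +>\<^bsub>M\<^esub> x \<in> carrier (M QuotM N)" if "x \<in> carrier M" for x
    using car that by blast
  note smult = quotient_smult_rcoset[OF N]
  have "abelian_group (M QuotM N)"
  proof (rule abelian_groupI)
    show "\<zero>\<^bsub>M QuotM N\<^esub> \<in> carrier (M QuotM N)"
      unfolding zero by (rule carI) simp
  next
    fix X assume "X \<in> carrier (M QuotM N)"
    then obtain x where x: "x \<in> carrier M" "X = N +>\<^bsub>M\<^esub> x"
      using car by blast
    show "\<zero>\<^bsub>M QuotM N\<^esub> \<oplus>\<^bsub>M QuotM N\<^esub> X = X"
      using x by (simp only: zero add M.zero_closed M.l_zero)
    have "(N +>\<^bsub>M\<^esub> (\<ominus>\<^bsub>M\<^esub> x)) \<oplus>\<^bsub>M QuotM N\<^esub> X = \<zero>\<^bsub>M QuotM N\<^esub>"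
      using x by (simp only: zero add M.a_inv_closed M.l_neg)
    then show "\<exists>Y\<in>carrier (M QuotM N). Y \<oplus>\<^bsub>M QuotM N\<^esub> X = \<zero>\<^bsub>M QuotM N\<^esub>"
      using carI M.a_inv_closed[OF x(1)] by blast
    fix Y assume "Y \<in> carrier (M QuotM N)"
    then obtain y where y: "y \<in> carrier M" "Y = N +>\<^bsub>M\<^esub> y"
      using car by blast
    show "X \<oplus>\<^bsub>M QuotM N\<^esub> Y \<in> carrier (M QuotM N)"
      using x y by (simp only: add M.a_closed carI)
    show "X \<oplus>\<^bsub>M QuotM N\<^esub> Y = Y \<oplus>\<^bsub>M QuotM N\<^esub> X"
      unfolding x(2) y(2) add[OF x(1) y(1)] add[OF y(1) x(1)] M.a_comm[OF x(1) y(1)] ..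
    fix Z assume "Z \<in> carrier (M QuotM N)"
    then obtain z where z: "z \<in> carrier M" "Z = N +>\<^bsub>M\<^esub> z"
      using car by blast
    show "(X \<oplus>\<^bsub>M QuotM N\<^esub> Y) \<oplus>\<^bsub>M QuotM N\<^esub> Z = X \<oplus>\<^bsub>M QuotM N\<^esub> (Y \<oplus>\<^bsub>M QuotM N\<^esub> Z)"
      using x y z by (simp only: add M.a_closed M.a_assoc)
  qed
  then show ?thesis
  proof (rule moduleI[OF R.is_cring])
    fix a X assume a: "a \<in> carrier R" and "X \<in> carrier (M QuotM N)"
    then obtain x where x: "x \<in> carrier M" "X = N +>\<^bsub>M\<^esub> x"
      using car by blast
    show "a \<odot>\<^bsub>M QuotM N\<^esub> X \<in> carrier (M QuotM N)"
      using a x by (simp only: smult smult_closed carI)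
    fix b assume b: "b \<in> carrier R"
    show "(a \<oplus>\<^bsub>R\<^esub> b) \<odot>\<^bsub>M QuotM N\<^esub> X =
        a \<odot>\<^bsub>M QuotM N\<^esub> X \<oplus>\<^bsub>M QuotM N\<^esub> b \<odot>\<^bsub>M QuotM N\<^esub> X"
      using a b x by (simp only: smult add smult_closed R.a_closed smult_l_distr)
    show "(a \<otimes>\<^bsub>R\<^esub> b) \<odot>\<^bsub>M QuotM N\<^esub> X = a \<odot>\<^bsub>M QuotM N\<^esub> (b \<odot>\<^bsub>M QuotM N\<^esub> X)"
      using a b x by (simp only: smult smult_closed R.m_closed smult_assoc1)
  next
    fix a X Y assume a: "a \<in> carrier R"
      and "X \<in> carrier (M QuotM N)" "Y \<in> carrier (M QuotM N)"
    then obtain x y where "x \<in> carrier M" "X = N +>\<^bsub>M\<^esub> x" "y \<in> carrier M" "Y = N +>\<^bsub>M\<^esub> y"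
      unfolding car by (elim bexE)
    then show "a \<odot>\<^bsub>M QuotM N\<^esub> (X \<oplus>\<^bsub>M QuotM N\<^esub> Y) =
        a \<odot>\<^bsub>M QuotM N\<^esub> X \<oplus>\<^bsub>M QuotM N\<^esub> a \<odot>\<^bsub>M QuotM N\<^esub> Y"
      using a by (simp only: smult add smult_closed M.a_closed smult_r_distr)
  next
    fix X assume "X \<in> carrier (M QuotM N)"
    then obtain x where "x \<in> carrier M" "X = N +>\<^bsub>M\<^esub> x"
      using car by blast
    then show "\<one>\<^bsub>R\<^esub> \<odot>\<^bsub>M QuotM N\<^esub> X = X"
      by (simp only: smult R.one_closed smult_one)
  qed
qed

end

theory Submission
  imports Defs
begin

text \<open>The prime \<open>\<pp>\<^sub>1\<close> must be the greatest element of \<open>Ass M\<close>, since \<open>Ass M\<^sub>1 \<subseteq> Ass M\<close> and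
  \<open>Ass M\<close> is contained in the set of all \<open>\<pp>\<^sub>i\<close>. The step \<open>M\<^sub>1\<close> is then forced as well: the elements of
  \<open>\<pp>\<^sub>1\<close> act locally nilpotently on a \<open>\<pp>\<^sub>1\<close>-coprimary module, so every associated prime of an image of
  that module contains \<open>\<pp>\<^sub>1\<close>; as the order extends inclusion, such a prime cannot be associated to the
  quotient by the first step of another filtration, whose associated primes are all \<open>< \<pp>\<^sub>1\<close>. Existence
  follows by Noetherian induction, taking for \<open>M\<^sub>1\<close> a submodule maximal with \<open>Ass M\<^sub>1 \<subseteq> {\<pp>\<^sub>1}\<close>.\<close>

section \<open>Conductors and relative associated primes\<close>

lemma (in noetherian_ring) wf_ideals: "wf {(J, I). ideal I R \<and> ideal J R \<and> I \<subset> J}"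
proof (rule wfI_min)
  fix I :: "'a set" and Q assume IQ: "I \<in> Q"
  show "\<exists>I\<in>Q. \<forall>J. (J, I) \<in> {(J, I). ideal I R \<and> ideal J R \<and> I \<subset> J} \<longrightarrow> J \<notin> Q"
  proof (cases "ideal I R")
    case True
    have "\<exists>I\<in>{I \<in> Q. ideal I R}. \<forall>J\<in>{I \<in> Q. ideal I R}. I \<subseteq> J \<longrightarrow> J = I"
    proof (rule subset_Zorn)
      fix C assume C: "subset.chain {I \<in> Q. ideal I R} C"
      show "\<exists>U\<in>{I \<in> Q. ideal I R}. \<forall>X\<in>C. X \<subseteq> U"
      proof (cases "C = {}")
        case True
        then show ?thesis using IQ \<open>ideal I R\<close> by blast
      next
        case False
        \<comment> \<open>A non-empty chain of ideals in a Noetherian ring contains its union, which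
          is thus the upper bound that Zorn's lemma asks for.\<close>
        have "subset.chain {I. ideal I R} C"
          using C by (auto simp: subset.chain_def)
        from ideal_chain_is_trivial[OF False this] C show ?thesis
          by (auto simp: subset.chain_def intro!: bexI[of _ "\<Union>C"])
      qed
    qed
    then show ?thesis by blast
  next
    case False
    then show ?thesis using IQ by blast
  qed
qed

lemma (in noetherian_ring) maximal_ideal_in_set:
  assumes "I \<in> Q" and ideal: "\<And>J. J \<in> Q \<Longrightarrow> ideal J R"
  obtains P where "P \<in> Q" "\<And>J. J \<in> Q \<Longrightarrow> P \<subseteq> J \<Longrightarrow> J = P"
proof (rule wfE_min[OF wf_ideals assms(1)])
  fix P assume "P \<in> Q" and "\<And>J. (J, P) \<in> {(J, I). ideal I R \<and> ideal J R \<and> I \<subset> J} \<Longrightarrow> J \<notin> Q"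
  then show thesis using ideal by (intro that[of P]) blast+
qed

context module
begin

text \<open>\<open>conductor H s\<close> is the annihilator of the class of \<open>s\<close> modulo \<open>H\<close>, so that \<open>Ass_over N H\<close> is
  \<open>Ass (N / H)\<close>; working relative to \<open>H\<close> keeps every argument inside \<open>M\<close>.\<close>

definition conductor :: "'c set \<Rightarrow> 'c \<Rightarrow> 'a set"
  where "conductor H s = {a \<in> carrier R. a \<odot>\<^bsub>M\<^esub> s \<in> H}"

definition Ass_over :: "'c set \<Rightarrow> 'c set \<Rightarrow> 'a set set"
  where "Ass_over N H = {\<pp> \<in> Spec R. \<exists>s\<in>N. \<pp> = conductor H s}"

text \<open>For a submodule \<open>H\<close> and \<open>s\<close> in \<open>M\<close> this is the
  submodule \<open>H + R s\<close>; modulo \<open>H\<close> it is cyclic, isomorphic to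
  \<open>R / conductor H s\<close>.\<close>

definition adjoin :: "'c set \<Rightarrow> 'c \<Rightarrow> 'c set"
  where "adjoin H s = {h \<oplus>\<^bsub>M\<^esub> a \<odot>\<^bsub>M\<^esub> s | h a. h \<in> H \<and> a \<in> carrier R}"

section \<open>Elementary properties of submodules and conductors\<close>

lemma submodule_zero: "submodule H R M \<Longrightarrow> \<zero>\<^bsub>M\<^esub> \<in> H"
  using subgroup.one_closed[OF submodule.axioms(1)] by fastforce

lemma submodule_carrier: "submodule H R M \<Longrightarrow> x \<in> H \<Longrightarrow> x \<in> carrier M"
  using submoduleE(1) by blast

lemma submodule_Int:
  assumes "submodule H R M" "submodule K R M"
  shows "submodule (H \<inter> K) R M"
  by (rule submoduleI) (use assms submoduleE submodule_zero in \<open>auto\<close>)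

lemma submodule_singleton_zero: "submodule {\<zero>\<^bsub>M\<^esub>} R M"
  by (rule submoduleI) auto

lemma submodule_add_cancel:
  assumes H: "submodule H R M" and h: "h \<in> H" and x: "x \<in> carrier M"
  shows "h \<oplus>\<^bsub>M\<^esub> x \<in> H \<longleftrightarrow> x \<in> H"
proof
  assume "h \<oplus>\<^bsub>M\<^esub> x \<in> H"
  then have "\<ominus>\<^bsub>M\<^esub> h \<oplus>\<^bsub>M\<^esub> (h \<oplus>\<^bsub>M\<^esub> x) \<in> H"
    using submoduleE(3,5)[OF H] h by blast
  then show "x \<in> H"
    using submodule_carrier[OF H h] x by (simp add: M.r_neg1)
qed (use submoduleE(5)[OF H h] in blast)

lemma conductor_ideal:
  assumes H: "submodule H R M" and s: "s \<in> carrier M"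
  shows "ideal (conductor H s) R"
proof (rule idealI[OF R.ring_axioms])
  show "subgroup (conductor H s) (add_monoid R)"
    by (rule R.add.subgroupI)
      (use s submoduleE[OF H] submodule_zero[OF H] in
        \<open>auto simp: conductor_def smult_l_distr smult_l_minus intro: exI[of _ \<zero>]\<close>)
next
  fix a x assume "a \<in> conductor H s" "x \<in> carrier R"
  then show "x \<otimes> a \<in> conductor H s"
    using s submoduleE(4)[OF H] by (auto simp: conductor_def smult_assoc1)
  then show "a \<otimes> x \<in> conductor H s"
    using \<open>a \<in> conductor H s\<close> \<open>x \<in> carrier R\<close> by (auto simp: conductor_def R.m_comm)
qed

lemma conductor_eq_carrier_iff:
  assumes H: "submodule H R M" and s: "s \<in> carrier M"
  shows "conductor H s = carrier R \<longleftrightarrow> s \<in> H"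
proof
  assume "conductor H s = carrier R"
  then have "\<one> \<in> conductor H s" by simp
  then show "s \<in> H" using s by (simp add: conductor_def)
qed (use submoduleE(4)[OF H] in \<open>auto simp: conductor_def\<close>)

text \<open>When \<open>H\<close> is a submodule, this is the colon ideal of
  \<open>conductor H s\<close> by \<open>a\<close>.\<close>

lemma conductor_smult:
  assumes "a \<in> carrier R" "s \<in> carrier M"
  shows "conductor H (a \<odot>\<^bsub>M\<^esub> s) = {b \<in> carrier R. b \<otimes> a \<in> conductor H s}"
  using assms by (auto simp: conductor_def smult_assoc1)

lemma conductor_add:
  assumes H: "submodule H R M" and h: "h \<in> H" and s: "s \<in> carrier M"
  shows "conductor H (h \<oplus>\<^bsub>M\<^esub> s) = conductor H s"
  unfolding conductor_def using assms submoduleE(1)[OF H] submoduleE(4)[OF H]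
  by (intro Collect_cong conj_cong refl) (auto simp: smult_r_distr submodule_add_cancel)

lemma Ass_over_notin:
  assumes "submodule H R M" "s \<in> carrier M" "conductor H s \<in> Spec R"
  shows "s \<notin> H"
  using assms conductor_eq_carrier_iff primeideal.I_notcarr unfolding Spec_def by blast

lemma Ass_over_mono: "N \<subseteq> N' \<Longrightarrow> Ass_over N H \<subseteq> Ass_over N' H"
  unfolding Ass_over_def by blast

lemma Ass_over_self:
  assumes "submodule H R M"
  shows "Ass_over H H = {}"
  using assms Ass_over_notin submodule_carrier unfolding Ass_over_def by blast

section \<open>Cyclic extensions, exact sequences and subquotients\<close>

lemma adjoin_submodule:
  assumes H: "submodule H R M" and s: "s \<in> carrier M"
  shows "submodule (adjoin H s) R M"
proof (rule submoduleI)
  note Hc = submodule_carrier[OF H]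
  show "adjoin H s \<subseteq> carrier M"
    using Hc s by (auto simp: adjoin_def)
  have "\<zero>\<^bsub>M\<^esub> = \<zero>\<^bsub>M\<^esub> \<oplus>\<^bsub>M\<^esub> \<zero> \<odot>\<^bsub>M\<^esub> s" using s by simp
  then show "\<zero>\<^bsub>M\<^esub> \<in> adjoin H s"
    using submodule_zero[OF H] R.zero_closed unfolding adjoin_def by blast
next
  fix x assume "x \<in> adjoin H s"
  then obtain h a where h: "h \<in> H" "a \<in> carrier R" "x = h \<oplus>\<^bsub>M\<^esub> a \<odot>\<^bsub>M\<^esub> s"
    unfolding adjoin_def by blast
  have hc: "h \<in> carrier M" using submodule_carrier[OF H] h by blast
  have "\<ominus>\<^bsub>M\<^esub> x = \<ominus>\<^bsub>M\<^esub> h \<oplus>\<^bsub>M\<^esub> (\<ominus> a) \<odot>\<^bsub>M\<^esub> s"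
    using h hc s by (simp add: M.minus_add smult_l_minus)
  then show "\<ominus>\<^bsub>M\<^esub> x \<in> adjoin H s"
    using submoduleE(3)[OF H h(1)] R.a_inv_closed[OF h(2)] unfolding adjoin_def by blast
  fix y assume "y \<in> adjoin H s"
  then obtain k b where k: "k \<in> H" "b \<in> carrier R" "y = k \<oplus>\<^bsub>M\<^esub> b \<odot>\<^bsub>M\<^esub> s"
    unfolding adjoin_def by blast
  have kc: "k \<in> carrier M" using submodule_carrier[OF H] k by blast
  have "x \<oplus>\<^bsub>M\<^esub> y = (h \<oplus>\<^bsub>M\<^esub> k) \<oplus>\<^bsub>M\<^esub> (a \<oplus> b) \<odot>\<^bsub>M\<^esub> s"
    using h k hc kc s by (simp add: smult_l_distr M.a_ac)
  then show "x \<oplus>\<^bsub>M\<^esub> y \<in> adjoin H s"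
    using submoduleE(5)[OF H h(1) k(1)] R.a_closed[OF h(2) k(2)] unfolding adjoin_def by blast
next
  fix c x assume c: "c \<in> carrier R" and "x \<in> adjoin H s"
  then obtain h a where h: "h \<in> H" "a \<in> carrier R" "x = h \<oplus>\<^bsub>M\<^esub> a \<odot>\<^bsub>M\<^esub> s"
    unfolding adjoin_def by blast
  have hc: "h \<in> carrier M" using submodule_carrier[OF H] h by blast
  have "c \<odot>\<^bsub>M\<^esub> x = c \<odot>\<^bsub>M\<^esub> h \<oplus>\<^bsub>M\<^esub> (c \<otimes> a) \<odot>\<^bsub>M\<^esub> s"
    using h hc s c by (simp add: smult_r_distr smult_assoc1)
  then show "c \<odot>\<^bsub>M\<^esub> x \<in> adjoin H s"
    using submoduleE(4)[OF H c h(1)] R.m_closed[OF c h(2)] unfolding adjoin_def by blast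
qed

lemma subset_adjoin:
  assumes "submodule H R M" "s \<in> carrier M"
  shows "H \<subseteq> adjoin H s"
proof
  fix h assume h: "h \<in> H"
  then have "h = h \<oplus>\<^bsub>M\<^esub> \<zero> \<odot>\<^bsub>M\<^esub> s"
    using assms submodule_carrier[OF assms(1)] by simp
  then show "h \<in> adjoin H s"
    using h R.zero_closed unfolding adjoin_def by blast
qed

lemma self_in_adjoin:
  assumes "submodule H R M" "s \<in> carrier M"
  shows "s \<in> adjoin H s"
proof -
  have "s = \<zero>\<^bsub>M\<^esub> \<oplus>\<^bsub>M\<^esub> \<one> \<odot>\<^bsub>M\<^esub> s" using assms by simp
  then show ?thesis
    using submodule_zero[OF assms(1)] R.one_closed unfolding adjoin_def by blast
qed

lemma adjoin_subset:
  assumes "submodule N R M" "H \<subseteq> N" "s \<in> N"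
  shows "adjoin H s \<subseteq> N"
  using assms submoduleE(4,5)[OF assms(1)] unfolding adjoin_def by blast

text \<open>Modulo \<open>H\<close> the extension is \<open>R / \<pp>\<close> with
  \<open>\<pp> = conductor H s\<close>. As \<open>R / \<pp>\<close> is a domain, each of its
  non-zero elements has annihilator \<open>\<pp>\<close>.\<close>

lemma Ass_over_adjoin:
  assumes H: "submodule H R M" and s: "s \<in> carrier M" and p: "conductor H s \<in> Spec R"
  shows "Ass_over (adjoin H s) H = {conductor H s}"
proof -
  interpret p: primeideal "conductor H s" R using p by (simp add: Spec_def)
  have "\<qq> = conductor H s" if assoc: "\<qq> \<in> Ass_over (adjoin H s) H" for \<qq>
  proof -
    obtain h a where ha: "h \<in> H" "a \<in> carrier R" "\<qq> = conductor H (h \<oplus>\<^bsub>M\<^esub> a \<odot>\<^bsub>M\<^esub> s)"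
        and q: "\<qq> \<in> Spec R"
      using assoc unfolding Ass_over_def adjoin_def by blast
    then have \<qq>: "\<qq> = {b \<in> carrier R. b \<otimes> a \<in> conductor H s}"
      using s by (simp add: conductor_add[OF H] conductor_smult)
    have "a \<notin> conductor H s"
    proof
      assume "a \<in> conductor H s"
      then have "\<qq> = carrier R" using \<qq> p.I_l_closed by blast
      then show False using q primeideal.I_notcarr by (auto simp: Spec_def)
    qed
    then show ?thesis
      using \<qq> ha(2) p.I_prime p.I_r_closed p.a_subset by blast
  qed
  moreover have "conductor H s \<in> Ass_over (adjoin H s) H"
    using p self_in_adjoin[OF H s] by (auto simp: Ass_over_def)
  ultimately show ?thesis by blast
qed

text \<open>For \<open>N \<subseteq> L\<close> this concerns 0 -> N/H -> L/H -> L/N -> 0. An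
  \<open>s\<close> with prime conductor \<open>\<pp>\<close> generates modulo \<open>H\<close> a
  copy of \<open>R / \<pp>\<close>, all of whose non-zero elements have annihilator
  \<open>\<pp>\<close>. Either one of them comes from \<open>N\<close>, or the copy embeds into
  L/N.\<close>

lemma Ass_over_exact:
  assumes H: "submodule H R M" and N: "submodule N R M" and L: "submodule L R M"
    and HN: "H \<subseteq> N"
  shows "Ass_over L H \<subseteq> Ass_over N H \<union> Ass_over L N"
proof
  fix \<pp> assume "\<pp> \<in> Ass_over L H"
  then obtain s where s: "s \<in> L" "\<pp> = conductor H s" and p: "\<pp> \<in> Spec R"
    unfolding Ass_over_def by blast
  interpret p: primeideal \<pp> R using p by (simp add: Spec_def)
  have sM: "s \<in> carrier M" using submodule_carrier[OF L s(1)] .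
  show "\<pp> \<in> Ass_over N H \<union> Ass_over L N"
  proof (cases "\<exists>a\<in>carrier R. a \<odot>\<^bsub>M\<^esub> s \<in> N \<and> a \<odot>\<^bsub>M\<^esub> s \<notin> H")
    case True
    then obtain a where a: "a \<in> carrier R" "a \<odot>\<^bsub>M\<^esub> s \<in> N" "a \<notin> \<pp>"
      unfolding s(2) conductor_def by blast
    have "conductor H (a \<odot>\<^bsub>M\<^esub> s) = \<pp>"
      unfolding conductor_smult[OF a(1) sM] s(2)[symmetric]
      using a(1,3) p.I_prime p.I_r_closed p.a_subset by blast
    then show ?thesis using a(2) p unfolding Ass_over_def by blast
  next
    case False
    then have "conductor N s = \<pp>" unfolding s(2) conductor_def using HN by blast
    then show ?thesis using s(1) p unfolding Ass_over_def by blast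
  qed
qed

text \<open>The bridge from the module of cosets to the relative notion: \<open>a\<close> kills the
  class of \<open>s\<close> exactly when \<open>a s\<close> lies in \<open>H\<close>.\<close>

lemma Ass_subquotient:
  assumes N: "submodule N R M" and H: "submodule H R M" and HN: "H \<subseteq> N"
  shows "Ass R (subquotient M N H) = Ass_over N H"
proof -
  let ?N = "M\<lparr>carrier := N\<rparr>"
  interpret N: module R ?N
    by (rule submodule.submodule_is_module[OF N module_axioms])
  have sub: "submodule H R ?N"
    by (rule N.module_incl_imp_submodule)
      (use HN submodule.submodule_is_module[OF H module_axioms] in auto)
  have mem: "X \<in> carrier (subquotient M N H) \<longleftrightarrow> (\<exists>s\<in>N. X = H +>\<^bsub>?N\<^esub> s)" for X
    by (auto simp: subquotient_def quotient_module_def A_RCOSETS_def')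
  have ann: "annihilator R (subquotient M N H) (H +>\<^bsub>?N\<^esub> s) = conductor H s" if s: "s \<in> N" for s
  proof -
    have "a \<odot>\<^bsub>subquotient M N H\<^esub> (H +>\<^bsub>?N\<^esub> s) = \<zero>\<^bsub>subquotient M N H\<^esub>
        \<longleftrightarrow> a \<odot>\<^bsub>M\<^esub> s \<in> H" if a: "a \<in> carrier R" for a
    proof -
      have as: "a \<odot>\<^bsub>M\<^esub> s \<in> N" using submoduleE(4)[OF N a s] .
      interpret sg: subgroup H "add_monoid ?N" using sub by (rule submodule.axioms(1))
      have "H +>\<^bsub>?N\<^esub> (a \<odot>\<^bsub>M\<^esub> s) = H \<longleftrightarrow> a \<odot>\<^bsub>M\<^esub> s \<in> H"
        using as sub N.M.add.coset_join1[OF _ _ sg.subgroup_axioms]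
          N.M.add.coset_join2[OF _ sg.subgroup_axioms] HN
        unfolding a_r_coset_def by auto
      then show ?thesis
        using N.quotient_smult_rcoset[OF sub a, of s] s
        by (simp add: subquotient_def) (simp add: quotient_module_def)
    qed
    then show ?thesis unfolding annihilator_def conductor_def by blast
  qed
  have "(\<exists>X\<in>carrier (subquotient M N H). \<pp> = annihilator R (subquotient M N H) X) \<longleftrightarrow>
      (\<exists>s\<in>N. \<pp> = conductor H s)" for \<pp>
    using mem ann by metis
  then show ?thesis
    unfolding Ass_def Ass_over_def by simp
qed

end

section \<open>Ascending chains of submodules\<close>

context module
begin

text \<open>A submodule \<open>A\<close> of \<open>K + R s\<close> is controlled by \<open>A \<inter> K\<close> and the ideal of those \<open>a\<close> with
  \<open>a s \<in> A + K\<close>: enlarging \<open>A\<close> while keeping the former strictly enlarges the latter.\<close>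

lemma wf_submodules_adjoin:
  assumes noeth: "noetherian_ring R"
    and K: "submodule K R M" and s: "s \<in> carrier M"
    and wf: "wf {(B, A). submodule A R M \<and> submodule B R M \<and> A \<subset> B \<and> B \<subseteq> K}"
  shows "wf {(B, A). submodule A R M \<and> submodule B R M \<and> A \<subset> B \<and> B \<subseteq> adjoin K s}"
proof -
  define I where "I A = {a \<in> carrier R. \<exists>k\<in>K. k \<oplus>\<^bsub>M\<^esub> a \<odot>\<^bsub>M\<^esub> s \<in> A}" for A
  note Kc = submodule_carrier[OF K]
  have ideal: "ideal (I A) R" if A: "submodule A R M" for A
  proof (rule idealI[OF R.ring_axioms])
    show "subgroup (I A) (add_monoid R)"
    proof (rule R.add.subgroupI)
      show "I A \<noteq> {}"
        using submodule_zero[OF A] submodule_zero[OF K] s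
        by (auto simp: I_def intro!: exI[of _ \<zero>] bexI[of _ "\<zero>\<^bsub>M\<^esub>"])
    next
      fix a assume "a \<in> I A"
      then obtain k where k: "a \<in> carrier R" "k \<in> K" "k \<oplus>\<^bsub>M\<^esub> a \<odot>\<^bsub>M\<^esub> s \<in> A"
        by (auto simp: I_def)
      have "\<ominus>\<^bsub>M\<^esub> k \<oplus>\<^bsub>M\<^esub> (\<ominus> a) \<odot>\<^bsub>M\<^esub> s \<in> A"
        using submoduleE(3)[OF A k(3)] k Kc s by (simp add: M.minus_add smult_l_minus)
      then have "\<ominus> a \<in> I A"
        using k submoduleE(3)[OF K k(2)] by (auto simp: I_def)
      then show "\<ominus> a \<in> I A" .
      fix b assume "b \<in> I A"
      then obtain l where l: "b \<in> carrier R" "l \<in> K" "l \<oplus>\<^bsub>M\<^esub> b \<odot>\<^bsub>M\<^esub> s \<in> A"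
        by (auto simp: I_def)
      have "(k \<oplus>\<^bsub>M\<^esub> l) \<oplus>\<^bsub>M\<^esub> (a \<oplus> b) \<odot>\<^bsub>M\<^esub> s =
          (k \<oplus>\<^bsub>M\<^esub> a \<odot>\<^bsub>M\<^esub> s) \<oplus>\<^bsub>M\<^esub> (l \<oplus>\<^bsub>M\<^esub> b \<odot>\<^bsub>M\<^esub> s)"
        using k l Kc s by (simp add: smult_l_distr M.a_ac)
      then have "(k \<oplus>\<^bsub>M\<^esub> l) \<oplus>\<^bsub>M\<^esub> (a \<oplus> b) \<odot>\<^bsub>M\<^esub> s \<in> A"
        using submoduleE(5)[OF A k(3) l(3)] by simp
      then show "a \<oplus> b \<in> I A"
        using k(1) l(1) submoduleE(5)[OF K k(2) l(2)] by (auto simp: I_def)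
    qed (auto simp: I_def)
  next
    fix a x assume "a \<in> I A" and x: "x \<in> carrier R"
    then obtain k where k: "a \<in> carrier R" "k \<in> K" "k \<oplus>\<^bsub>M\<^esub> a \<odot>\<^bsub>M\<^esub> s \<in> A"
      by (auto simp: I_def)
    have "x \<odot>\<^bsub>M\<^esub> k \<oplus>\<^bsub>M\<^esub> (x \<otimes> a) \<odot>\<^bsub>M\<^esub> s \<in> A"
      using submoduleE(4)[OF A x k(3)] k x Kc s by (simp add: smult_r_distr smult_assoc1)
    then show "x \<otimes> a \<in> I A"
      using x k(1) submoduleE(4)[OF K x k(2)] by (auto simp: I_def)
    then show "a \<otimes> x \<in> I A"
      using x k(1) by (simp add: R.m_comm)
  qed
  have strict: "I A \<subset> I B"
    if A: "submodule A R M" and B: "submodule B R M" and AB: "A \<subset> B"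
      and BK: "B \<subseteq> adjoin K s" and eq: "A \<inter> K = B \<inter> K" for A B
  proof -
    have "B \<subseteq> A" if IBA: "I B \<subseteq> I A"
    proof
      fix b assume b: "b \<in> B"
      then obtain k a where k: "k \<in> K" "a \<in> carrier R" "b = k \<oplus>\<^bsub>M\<^esub> a \<odot>\<^bsub>M\<^esub> s"
        using BK unfolding adjoin_def by blast
      then have "a \<in> I A" using IBA b by (auto simp: I_def)
      then obtain l where l: "l \<in> K" "l \<oplus>\<^bsub>M\<^esub> a \<odot>\<^bsub>M\<^esub> s \<in> A"
        by (auto simp: I_def)
      \<comment> \<open>Both elements have the coefficient \<open>a\<close> at \<open>s\<close>, so
        their difference \<open>d\<close> lies in \<open>K\<close>. It also lies in
        \<open>B\<close>, hence in \<open>B \<inter> K = A \<inter> K\<close>, and so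
        \<open>b\<close> is a sum of elements of \<open>A\<close>.\<close>
      define d where "d = k \<oplus>\<^bsub>M\<^esub> \<ominus>\<^bsub>M\<^esub> l"
      have dK: "d \<in> K"
        unfolding d_def using submoduleE(3,5)[OF K] k(1) l(1) by blast
      have b_eq: "b = d \<oplus>\<^bsub>M\<^esub> (l \<oplus>\<^bsub>M\<^esub> a \<odot>\<^bsub>M\<^esub> s)"
        unfolding d_def using k l Kc s by (simp add: M.a_assoc M.r_neg1)
      have "(l \<oplus>\<^bsub>M\<^esub> a \<odot>\<^bsub>M\<^esub> s) \<oplus>\<^bsub>M\<^esub> d \<in> B"
        using b b_eq k l Kc s dK by (simp add: M.a_comm)
      then have "d \<in> B"
        using submodule_add_cancel[OF B _ Kc[OF dK]] l(2) AB by blast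
      then have "d \<in> A" using dK eq by blast
      then show "b \<in> A" using b_eq submoduleE(5)[OF A] l(2) by blast
    qed
    moreover have "I A \<subseteq> I B" using AB by (auto simp: I_def)
    ultimately show ?thesis using AB by blast
  qed
  \<comment> \<open>Lexicographic measure: either the trace on \<open>K\<close> grows strictly, or
    it stays the same and the ideal \<open>I A\<close> grows strictly.\<close>
  let ?r = "{(B, A). submodule A R M \<and> submodule B R M \<and> A \<subset> B \<and> B \<subseteq> K} <*lex*>
      {(J, I). ideal I R \<and> ideal J R \<and> I \<subset> J}"
  have "wf (inv_image ?r (\<lambda>A. (A \<inter> K, I A)))"
    using wf noetherian_ring.wf_ideals[OF noeth] by (intro wf_inv_image wf_lex_prod)
  then show ?thesis
  proof (rule wf_subset, intro subrelI)
    fix B A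
    assume "(B, A) \<in> {(B, A). submodule A R M \<and> submodule B R M \<and> A \<subset> B \<and> B \<subseteq> adjoin K s}"
    then have BA: "submodule A R M" "submodule B R M" "A \<subset> B" "B \<subseteq> adjoin K s" by auto
    show "(B, A) \<in> inv_image ?r (\<lambda>A. (A \<inter> K, I A))"
    proof (cases "A \<inter> K = B \<inter> K")
      case True
      then show ?thesis using strict[OF BA] ideal BA(1,2) by (simp add: in_inv_image)
    next
      case False
      then show ?thesis using BA submodule_Int[OF _ K] by (auto simp: in_inv_image)
    qed
  qed
qed

text \<open>The generators are adjoined one at a time, starting from the zero submodule; each step
  preserves the ascending chain condition.\<close>

lemma wf_submodules:
  assumes noeth: "noetherian_ring R" and ft: "finite_type R M"
  shows "wf {(B, A). submodule A R M \<and> submodule B R M \<and> A \<subset> B}"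
proof -
  let ?r = "\<lambda>K. {(B, A). submodule A R M \<and> submodule B R M \<and> A \<subset> B \<and> B \<subseteq> K}"
  \<comment> \<open>Any \<open>K\<close> containing the generators will do: by the definition of
    \<open>genmodule\<close> it is all of \<open>M\<close>.\<close>
  have *: "\<exists>K. submodule K R M \<and> S \<subseteq> K \<and> wf (?r K)" if "finite S" "S \<subseteq> carrier M" for S
    using that
  proof (induction S)
    case empty
    have "?r {\<zero>\<^bsub>M\<^esub>} = {}" using submodule_zero by blast
    have "wf (?r {\<zero>\<^bsub>M\<^esub>})" unfolding \<open>?r {\<zero>\<^bsub>M\<^esub>} = {}\<close> by simp
    then show ?case using submodule_singleton_zero by blast
  next
    case (insert s S)
    then obtain K where K: "submodule K R M" "S \<subseteq> K" "wf (?r K)" by auto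
    have s: "s \<in> carrier M" using insert by simp
    show ?case
      using adjoin_submodule[OF K(1) s] wf_submodules_adjoin[OF noeth K(1) s K(3)]
        subset_adjoin[OF K(1) s] self_in_adjoin[OF K(1) s] K(2)
      by (intro exI[of _ "adjoin K s"]) auto
  qed
  obtain S where S: "S \<subseteq> carrier M" "finite S" "carrier M = genmodule R M S"
    using ft unfolding finite_type_def by blast
  obtain K where K: "submodule K R M" "S \<subseteq> K" "wf (?r K)" using *[OF S(2,1)] by blast
  have "carrier M \<subseteq> K"
    unfolding S(3) genmodule_def using K by blast
  then have "?r K = {(B, A). submodule A R M \<and> submodule B R M \<and> A \<subset> B}"
    using submoduleE(1) by blast
  with K(3) show ?thesis by simp
qed

end

lemma Spec_subset_carrier: "\<pp> \<in> Spec R \<Longrightarrow> \<pp> \<subseteq> carrier R"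
  unfolding Spec_def using primeideal.axioms(1) ideal.axioms(1) additive_subgroup.a_subset by blast

lemma (in primeideal) mem_of_pow_mem:
  assumes "a \<in> carrier R" "a [^] (n::nat) \<in> I"
  shows "a \<in> I"
  using assms(2)
proof (induction n)
  case 0
  then show ?case using one_imp_carrier I_notcarr by auto
next
  case (Suc n)
  then show ?case using assms(1) I_prime[of "a [^] n" a] by auto
qed

section \<open>Associated primes over Noetherian rings\<close>

locale finite_type_module = module +
  assumes noetherian: "noetherian_ring R" and finite_type: "finite_type R M"
begin

text \<open>A conductor that is maximal among those of the elements of \<open>N\<close> outside
  \<open>H\<close> is prime.\<close>

lemma Ass_over_nonempty:
  assumes H: "submodule H R M" and N: "submodule N R M" and NH: "\<not> N \<subseteq> H"
  shows "Ass_over N H \<noteq> {}"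
proof -
  note Nc = submodule_carrier[OF N]
  obtain s0 where "s0 \<in> N - H" using NH by blast
  then obtain P where "P \<in> conductor H ` (N - H)"
      and max: "\<And>J. J \<in> conductor H ` (N - H) \<Longrightarrow> P \<subseteq> J \<Longrightarrow> J = P"
    using noetherian_ring.maximal_ideal_in_set[OF noetherian, of "conductor H s0" "conductor H ` (N - H)"]
      conductor_ideal[OF H Nc] by blast
  then obtain s where s: "s \<in> N" "s \<notin> H" "P = conductor H s" by blast
  have "primeideal P R"
  proof (rule primeidealI)
    show ideal: "ideal P R" using conductor_ideal[OF H] Nc s by simp
    show "cring R" by (rule R.is_cring)
    show "carrier R \<noteq> P" using conductor_eq_carrier_iff[OF H] s Nc by blast
    fix a b assume ab: "a \<in> carrier R" "b \<in> carrier R" "a \<otimes> b \<in> P"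
    show "a \<in> P \<or> b \<in> P"
    proof (rule disjCI)
      assume "b \<notin> P"
      then have bs: "b \<odot>\<^bsub>M\<^esub> s \<in> N - H"
        using ab s submoduleE(4)[OF N] by (auto simp: conductor_def)
      \<comment> \<open>Passing from \<open>s\<close> to \<open>b s\<close> can only enlarge the
        conductor, so maximality makes the two equal; \<open>a\<close> kills \<open>b s\<close>
        modulo \<open>H\<close> and therefore lies in \<open>P\<close>.\<close>
      have "P \<subseteq> conductor H (b \<odot>\<^bsub>M\<^esub> s)"
        unfolding conductor_smult[OF ab(2) Nc[OF s(1)]] s(3)[symmetric]
        using ideal ab(2) by (auto simp: ideal.I_r_closed ideal.Icarr)
      then have "P = conductor H (b \<odot>\<^bsub>M\<^esub> s)"
        using max[of "conductor H (b \<odot>\<^bsub>M\<^esub> s)"] bs by blast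
      moreover have "a \<in> conductor H (b \<odot>\<^bsub>M\<^esub> s)"
        unfolding conductor_smult[OF ab(2) Nc[OF s(1)]] s(3)[symmetric] using ab by simp
      ultimately show "a \<in> P" by simp
    qed
  qed
  then show ?thesis using s unfolding Ass_over_def Spec_def by blast
qed

text \<open>A multiple \<open>t = a\<^sup>n s\<close> with maximal conductor has the same conductor as \<open>a t\<close>, so \<open>a\<close> is a
  non-zero-divisor on \<open>R t\<close> modulo \<open>H\<close>; but \<open>\<pp>\<close> is the conductor of some \<open>b t\<close> if \<open>t \<notin> H\<close>.\<close>

lemma pow_smult_mem:
  assumes H: "submodule H R M" and N: "submodule N R M" and HN: "H \<subseteq> N"
    and ass: "Ass_over N H \<subseteq> {\<pp>}" and p: "\<pp> \<in> Spec R" and a: "a \<in> \<pp>" and s: "s \<in> N"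
  shows "\<exists>n::nat. a [^] n \<odot>\<^bsub>M\<^esub> s \<in> H"
proof (rule ccontr)
  assume "\<not> ?thesis"
  then have notin: "a [^] n \<odot>\<^bsub>M\<^esub> s \<notin> H" for n :: nat by simp
  have ac: "a \<in> carrier R" using p a Spec_subset_carrier by blast
  note Nc = submodule_carrier[OF N]
  let ?c = "\<lambda>n::nat. conductor H (a [^] n \<odot>\<^bsub>M\<^esub> s)"
  have "a [^] n \<odot>\<^bsub>M\<^esub> s \<in> carrier M" for n :: nat using ac Nc[OF s] by simp
  then have "ideal J R" if "J \<in> range ?c" for J
    using that conductor_ideal[OF H] by blast
  then obtain P where "P \<in> range ?c" and max: "\<And>J. J \<in> range ?c \<Longrightarrow> P \<subseteq> J \<Longrightarrow> J = P"
    using noetherian_ring.maximal_ideal_in_set[OF noetherian, of "?c 0" "range ?c"] by blast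
  then obtain n where n: "P = ?c n" by blast
  define t where "t = a [^] n \<odot>\<^bsub>M\<^esub> s"
  have t: "t \<in> N" "t \<notin> H"
    unfolding t_def using notin submoduleE(4)[OF N _ s] ac by auto
  note tc = Nc[OF t(1)]
  have at: "a [^] Suc n \<odot>\<^bsub>M\<^esub> s = a \<odot>\<^bsub>M\<^esub> t"
    unfolding t_def using ac Nc[OF s] by (simp add: R.m_comm smult_assoc1[symmetric])
  interpret c: ideal "conductor H t" R using conductor_ideal[OF H tc] .
  have "conductor H t \<subseteq> conductor H (a \<odot>\<^bsub>M\<^esub> t)"
    unfolding conductor_smult[OF ac tc] using ac c.I_r_closed c.Icarr by blast
  moreover have "conductor H (a \<odot>\<^bsub>M\<^esub> t) \<in> range ?c"
    unfolding at[symmetric] by blast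
  ultimately have stable: "conductor H (a \<odot>\<^bsub>M\<^esub> t) = conductor H t"
    using max[of "conductor H (a \<odot>\<^bsub>M\<^esub> t)"] n
    unfolding t_def[symmetric] by blast
  have "\<not> adjoin H t \<subseteq> H" using self_in_adjoin[OF H tc] t(2) by blast
  then obtain \<qq> where q: "\<qq> \<in> Ass_over (adjoin H t) H"
    using Ass_over_nonempty[OF H adjoin_submodule[OF H tc]] by blast
  then have "\<qq> = \<pp>"
    using Ass_over_mono[OF adjoin_subset[OF N HN t(1)]] ass by blast
  with q obtain h b where b: "h \<in> H" "b \<in> carrier R" "\<pp> = conductor H (h \<oplus>\<^bsub>M\<^esub> b \<odot>\<^bsub>M\<^esub> t)"
    unfolding Ass_over_def adjoin_def by blast
  then have peq: "\<pp> = {c \<in> carrier R. c \<otimes> b \<in> conductor H t}"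
    using tc by (simp add: conductor_add[OF H] conductor_smult)
  \<comment> \<open>Since \<open>a \<in> \<pp>\<close> kills \<open>b t\<close> modulo
    \<open>H\<close>, \<open>b\<close> kills \<open>a t\<close>, hence also \<open>t\<close> by
    \<open>stable\<close>. Then \<open>b t \<in> H\<close>, and its conductor \<open>\<pp>\<close>
    would be the whole ring.\<close>
  have "b \<in> conductor H (a \<odot>\<^bsub>M\<^esub> t)"
    unfolding conductor_smult[OF ac tc] using a peq b(2) ac by (simp add: R.m_comm)
  then have "\<pp> = carrier R"
    unfolding stable peq using c.I_l_closed by blast
  then show False
    using p primeideal.I_notcarr by (auto simp: Spec_def)
qed

text \<open>If the image of \<open>N\<close> in M/L were non-zero, it would have an associated prime
  \<open>\<qq> = conductor L s\<close> with \<open>s \<in> N\<close>. Each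
  \<open>a \<in> \<pp>\<close> has a power sending \<open>s\<close> into
  \<open>H \<subseteq> L\<close>, so this power and then \<open>a\<close> itself lie in
  \<open>\<qq>\<close>, against \<open>no\<close>.\<close>

lemma coprimary_subset:
  assumes H: "submodule H R M" and N: "submodule N R M" and L: "submodule L R M"
    and HN: "H \<subseteq> N" and HL: "H \<subseteq> L"
    and ass: "Ass_over N H \<subseteq> {\<pp>}" and p: "\<pp> \<in> Spec R"
    and no: "\<And>\<qq>. \<qq> \<in> Ass_over (carrier M) L \<Longrightarrow> \<not> \<pp> \<subseteq> \<qq>"
  shows "N \<subseteq> L"
proof (rule ccontr)
  assume "\<not> N \<subseteq> L"
  then obtain \<qq> where q: "\<qq> \<in> Ass_over N L"
    using Ass_over_nonempty[OF L N] by blast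
  then obtain s where s: "s \<in> N" "\<qq> = conductor L s" and qS: "\<qq> \<in> Spec R"
    unfolding Ass_over_def by blast
  have "\<pp> \<subseteq> \<qq>"
  proof
    fix a assume a: "a \<in> \<pp>"
    then have ac: "a \<in> carrier R" using p Spec_subset_carrier by blast
    obtain n :: nat where "a [^] n \<odot>\<^bsub>M\<^esub> s \<in> H"
      using pow_smult_mem[OF H N HN ass p a s(1)] by blast
    then have "a [^] n \<in> \<qq>" using HL ac by (auto simp: s(2) conductor_def)
    then show "a \<in> \<qq>" using primeideal.mem_of_pow_mem ac qS by (auto simp: Spec_def)
  qed
  moreover have "\<qq> \<in> Ass_over (carrier M) L"
    using q Ass_over_mono submoduleE(1)[OF N] by blast
  ultimately show False using no by blast
qed

lemma maximal_submodule_in_set: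
  assumes "H \<in> Q" and sub: "\<And>L. L \<in> Q \<Longrightarrow> submodule L R M"
  shows "\<exists>N\<in>Q. \<forall>L\<in>Q. N \<subseteq> L \<longrightarrow> L = N"
proof (rule wfE_min[OF wf_submodules[OF noetherian finite_type] assms(1)])
  fix N assume N: "N \<in> Q"
    and "\<And>L. (L, N) \<in> {(B, A). submodule A R M \<and> submodule B R M \<and> A \<subset> B} \<Longrightarrow> L \<notin> Q"
  then show ?thesis using sub by (intro bexI[OF _ N]) blast
qed

text \<open>Induction on \<open>H\<close> from the top: enlarging \<open>H\<close> by an
  \<open>s\<close> with prime conductor loses at most that one prime.\<close>

lemma finite_Ass_over:
  assumes "submodule H R M"
  shows "finite (Ass_over (carrier M) H)"
  using wf_submodules[OF noetherian finite_type] assms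
proof (induction H rule: wf_induct_rule)
  case (less H)
  note H = less.prems
  show ?case
  proof (cases "Ass_over (carrier M) H = {}")
    case False
    then obtain s where s: "s \<in> carrier M" "conductor H s \<in> Spec R"
      unfolding Ass_over_def by blast
    let ?N = "adjoin H s"
    have N: "submodule ?N R M" "H \<subseteq> ?N"
      using adjoin_submodule[OF H s(1)] subset_adjoin[OF H s(1)] by auto
    then have "H \<subset> ?N"
      using self_in_adjoin[OF H s(1)] Ass_over_notin[OF H s] by blast
    then have "finite (Ass_over (carrier M) ?N)" using less N H by blast
    then show ?thesis
      using Ass_over_exact[OF H N(1) carrier_is_submodule N(2)] Ass_over_adjoin[OF H s]
        finite_subset by fastforce
  qed simp
qed

end

section \<open>Coprimary filtrations\<close>

locale finite_type_module_ordered_Spec = finite_type_module +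
  fixes le :: "'a set rel"
  assumes linear: "linear_order_on (Spec R) le"
    and extends: "\<And>\<pp> \<qq>. \<pp> \<in> Spec R \<Longrightarrow> \<qq> \<in> Spec R \<Longrightarrow> \<pp> \<subseteq> \<qq> \<Longrightarrow> (\<pp>, \<qq>) \<in> le"
begin

text \<open>The base \<open>H\<close> stays outside the list, so that dropping the first step leaves
  a flag over \<open>N\<close>; this makes induction on the base possible. Each prime is compared
  with all later ones, as in \<open>sorted_wrt\<close>.\<close>

fun flag :: "'c set \<Rightarrow> 'c set list \<Rightarrow> 'a set list \<Rightarrow> bool" where
  "flag H [] [] \<longleftrightarrow> H = carrier M"
| "flag H (N # Ns) (\<pp> # \<pp>s) \<longleftrightarrow>
    submodule N R M \<and> H \<subset> N \<and> Ass_over N H = {\<pp>} \<and>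
    (\<forall>\<qq>\<in>set \<pp>s. (\<qq>, \<pp>) \<in> le \<and> \<qq> \<noteq> \<pp>) \<and> flag N Ns \<pp>s"
| "flag _ _ _ \<longleftrightarrow> False"

lemma le_antisym: "(\<pp>, \<qq>) \<in> le \<Longrightarrow> (\<qq>, \<pp>) \<in> le \<Longrightarrow> \<pp> = \<qq>"
  using linear unfolding order_on_defs antisym_def by blast

lemma le_trans: "(\<pp>, \<qq>) \<in> le \<Longrightarrow> (\<qq>, \<rr>) \<in> le \<Longrightarrow> (\<pp>, \<rr>) \<in> le"
  using linear unfolding order_on_defs trans_def by blast

lemma le_total: "\<pp> \<in> Spec R \<Longrightarrow> \<qq> \<in> Spec R \<Longrightarrow> (\<pp>, \<qq>) \<in> le \<or> (\<qq>, \<pp>) \<in> le"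
  using linear extends[of \<pp> \<pp>] unfolding order_on_defs total_on_def
  by (cases "\<pp> = \<qq>") auto

lemma Ass_over_Spec: "Ass_over N H \<subseteq> Spec R"
  unfolding Ass_over_def by blast

lemma greatest_prime:
  assumes "finite A" "A \<noteq> {}" "A \<subseteq> Spec R"
  obtains \<pp> where "\<pp> \<in> A" "\<And>\<qq>. \<qq> \<in> A \<Longrightarrow> (\<qq>, \<pp>) \<in> le"
proof -
  have "\<exists>\<pp>\<in>A. \<forall>\<qq>\<in>A. (\<qq>, \<pp>) \<in> le"
    using assms
  proof (induction A rule: finite_ne_induct)
    case (singleton \<pp>)
    then show ?case using extends by blast
  next
    case (insert \<pp> A)
    then obtain \<mm> where m: "\<mm> \<in> A" "\<forall>\<qq>\<in>A. (\<qq>, \<mm>) \<in> le" by auto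
    have "(\<pp>, \<mm>) \<in> le \<or> (\<mm>, \<pp>) \<in> le" "(\<pp>, \<pp>) \<in> le"
      using le_total insert.prems m(1) extends by blast+
    then show ?case using m le_trans by blast
  qed
  then show ?thesis using that by blast
qed

section \<open>Uniqueness of flags\<close>

lemma Ass_over_flag:
  assumes "flag H Ns \<pp>s" "submodule H R M"
  shows "Ass_over (carrier M) H \<subseteq> set \<pp>s"
  using assms
proof (induction H Ns \<pp>s rule: flag.induct)
  case (1 H)
  then show ?case using Ass_over_self by simp
next
  case (2 H N Ns \<pp> \<pp>s)
  then show ?case
    using Ass_over_exact[of H N "carrier M"] carrier_is_submodule by auto
qed auto

text \<open>The first prime of a flag is thus determined by the bottom submodule alone: it is the greatest
  associated prime of the quotient.\<close>

lemma flag_first: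
  assumes "flag H (N # Ns) (\<pp> # \<pp>s)" "submodule H R M"
  shows "\<pp> \<in> Ass_over (carrier M) H"
    and "\<qq> \<in> Ass_over (carrier M) H \<Longrightarrow> (\<qq>, \<pp>) \<in> le"
proof -
  have N: "submodule N R M" "Ass_over N H = {\<pp>}" using assms by auto
  show p: "\<pp> \<in> Ass_over (carrier M) H"
    using Ass_over_mono[of N "carrier M" H] submoduleE(1)[OF N(1)] N(2) by blast
  then have "(\<pp>, \<pp>) \<in> le" using extends Ass_over_Spec by blast
  then show "(\<qq>, \<pp>) \<in> le" if "\<qq> \<in> Ass_over (carrier M) H"
    using that Ass_over_flag[OF assms] assms(1) by auto
qed

text \<open>The primes associated to M/N' occur among the later primes of the second flag, so they
  are strictly below \<open>\<pp>\<close>. None contains \<open>\<pp>\<close>, since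
  \<open>le\<close> extends inclusion.\<close>

lemma flag_first_subset:
  assumes H: "submodule H R M"
    and f: "flag H (N # Ns) (\<pp> # \<pp>s)" and f': "flag H (N' # Ns') (\<pp> # \<pp>s')"
  shows "N \<subseteq> N'"
proof (rule coprimary_subset[OF H])
  show "submodule N R M" "submodule N' R M" "H \<subseteq> N" "H \<subseteq> N'" "Ass_over N H \<subseteq> {\<pp>}"
    using f f' by auto
  show p: "\<pp> \<in> Spec R" using flag_first(1)[OF f H] Ass_over_Spec by blast
  fix \<qq> assume q: "\<qq> \<in> Ass_over (carrier M) N'"
  then have "\<qq> \<in> set \<pp>s'" using Ass_over_flag f' by auto
  then have "(\<qq>, \<pp>) \<in> le" "\<qq> \<noteq> \<pp>" using f' by auto
  then show "\<not> \<pp> \<subseteq> \<qq>" using extends[OF p] le_antisym q Ass_over_Spec by blast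
qed

lemma flag_unique:
  assumes "flag H Ns \<pp>s" "flag H Ns' \<pp>s'" "submodule H R M"
  shows "Ns = Ns' \<and> \<pp>s = \<pp>s'"
  using assms
proof (induction H Ns \<pp>s arbitrary: Ns' \<pp>s' rule: flag.induct)
  case (1 H)
  then show ?case
    by (cases Ns'; cases \<pp>s') (auto dest: submoduleE(1))
next
  case (2 H N Ns \<pp> \<pp>s)
  then have HM: "H \<subset> carrier M" using submoduleE(1) by auto
  then obtain N' Ms \<qq> \<qq>s where eq: "Ns' = N' # Ms" "\<pp>s' = \<qq> # \<qq>s"
    using 2 by (cases Ns'; cases \<pp>s') auto
  note f = 2(2) and f' = 2(3)[unfolded eq] and H = 2(4)
  \<comment> \<open>Both primes are the greatest element of the same set
    \<open>Ass_over (carrier M) H\<close>.\<close>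
  have pq: "\<qq> = \<pp>"
    using flag_first[OF f H] flag_first[OF f' H] le_antisym by blast
  have "N' = N"
    using flag_first_subset[OF H f f'[unfolded pq]] flag_first_subset[OF H f'[unfolded pq] f] by blast
  moreover have "Ns = Ms \<and> \<pp>s = \<qq>s"
    using 2(1)[of Ms \<qq>s] f f' \<open>N' = N\<close> by simp
  ultimately show ?case using eq pq by simp
qed auto

text \<open>The next step above \<open>H\<close> is a submodule \<open>N\<close> maximal with \<open>Ass (N / H) \<subseteq> {\<pp>}\<close>, where \<open>\<pp>\<close> is the
  greatest element of \<open>Ass (M / H)\<close>. For \<open>\<qq> \<in> Ass (M / N)\<close> the extension of \<open>N\<close> by \<open>R / \<qq>\<close> has associated
  primes in \<open>{\<pp>, \<qq>}\<close>, so maximality forces \<open>\<qq> \<noteq> \<pp>\<close> and \<open>\<qq> \<in> Ass (M / H)\<close>.\<close>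

lemma flag_exists:
  assumes "submodule H R M"
  shows "\<exists>Ns \<pp>s. flag H Ns \<pp>s"
  using wf_submodules[OF noetherian finite_type] assms
proof (induction H rule: wf_induct_rule)
  case (less H)
  note H = less.prems
  show ?case
  proof (cases "H = carrier M")
    case True
    then show ?thesis using flag.simps(1) by blast
  next
    case False
    then have "\<not> carrier M \<subseteq> H" using submoduleE(1)[OF H] by blast
    then have "Ass_over (carrier M) H \<noteq> {}"
      using Ass_over_nonempty[OF H carrier_is_submodule] by blast
    then obtain \<pp> where p: "\<pp> \<in> Ass_over (carrier M) H"
        and p_max: "\<And>\<qq>. \<qq> \<in> Ass_over (carrier M) H \<Longrightarrow> (\<qq>, \<pp>) \<in> le"
      using greatest_prime[OF finite_Ass_over[OF H] _ Ass_over_Spec] by blast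
    let ?Q = "{N. submodule N R M \<and> H \<subseteq> N \<and> Ass_over N H \<subseteq> {\<pp>}}"
    have HQ: "H \<in> ?Q" using H Ass_over_self[OF H] by blast
    have "\<exists>N\<in>?Q. \<forall>L\<in>?Q. N \<subseteq> L \<longrightarrow> L = N"
      by (rule maximal_submodule_in_set[OF HQ]) simp
    then obtain N where NQ: "N \<in> ?Q" and max: "\<forall>L\<in>?Q. N \<subseteq> L \<longrightarrow> L = N"
      by (elim bexE)
    from NQ have N: "submodule N R M" "H \<subseteq> N" "Ass_over N H \<subseteq> {\<pp>}" by simp_all
    \<comment> \<open>A witness \<open>s\<close> for \<open>\<pp>\<close> gives the cyclic extension
      \<open>adjoin H s\<close>, a member of \<open>?Q\<close> strictly above \<open>H\<close>; so
      \<open>H\<close> itself is not maximal.\<close>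
    have HN: "H \<subset> N"
    proof (rule psubsetI[OF N(2)], rule)
      assume "H = N"
      obtain s where s: "s \<in> carrier M" "\<pp> = conductor H s" "conductor H s \<in> Spec R"
        using p unfolding Ass_over_def by blast
      have "adjoin H s \<in> ?Q"
        using adjoin_submodule[OF H s(1)] subset_adjoin[OF H s(1)] Ass_over_adjoin[OF H s(1,3)] s(2)
        by auto
      moreover have "H \<subset> adjoin H s"
        using subset_adjoin[OF H s(1)] self_in_adjoin[OF H s(1)] Ass_over_notin[OF H s(1,3)] by blast
      ultimately show False using bspec[OF max, of "adjoin H s"] \<open>H = N\<close> by simp
    qed
    then have ass: "Ass_over N H = {\<pp>}"
      using Ass_over_nonempty[OF H N(1)] N(3) by blast
    have rest: "(\<qq>, \<pp>) \<in> le \<and> \<qq> \<noteq> \<pp>" if q: "\<qq> \<in> Ass_over (carrier M) N" for \<qq>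
    proof -
      obtain s where s: "s \<in> carrier M" "\<qq> = conductor N s" "conductor N s \<in> Spec R"
        using q unfolding Ass_over_def by blast
      let ?L = "adjoin N s"
      have L: "submodule ?L R M" using adjoin_submodule[OF N(1) s(1)] .
      have NL: "N \<subset> ?L"
        using subset_adjoin[OF N(1) s(1)] self_in_adjoin[OF N(1) s(1)]
          Ass_over_notin[OF N(1) s(1,3)] by blast
      have "Ass_over ?L H \<subseteq> {\<pp>, \<qq>}"
        using Ass_over_exact[OF H N(1) L N(2)] N(3) Ass_over_adjoin[OF N(1) s(1,3)] s(2) by blast
      moreover have "\<not> Ass_over ?L H \<subseteq> {\<pp>}"
        using bspec[OF max, of ?L] L NL N(1,2) by blast
      ultimately have "\<qq> \<noteq> \<pp>" "\<qq> \<in> Ass_over ?L H" by auto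
      then show ?thesis
        using p_max Ass_over_mono[OF submoduleE(1)[OF L]] by blast
    qed
    obtain Ns \<pp>s where f: "flag N Ns \<pp>s"
      using less.IH[of N] HN H N(1) by blast
    \<comment> \<open>\<open>rest\<close> speaks of primes associated to M/N only. The first prime
      of the flag over \<open>N\<close> is one of these, and the later primes lie below it.\<close>
    have "(\<qq>, \<pp>) \<in> le \<and> \<qq> \<noteq> \<pp>" if q: "\<qq> \<in> set \<pp>s" for \<qq>
    proof -
      obtain N' Ns' \<pp>' \<pp>s' where eq: "Ns = N' # Ns'" "\<pp>s = \<pp>' # \<pp>s'"
        using f q by (cases Ns; cases \<pp>s) auto
      have "(\<pp>', \<pp>) \<in> le \<and> \<pp>' \<noteq> \<pp>"
        using rest flag_first(1)[OF f[unfolded eq] N(1)] by blast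
      moreover have "\<qq> = \<pp>' \<or> (\<qq>, \<pp>') \<in> le \<and> \<qq> \<noteq> \<pp>'"
        using f q eq by auto
      ultimately show ?thesis using le_trans le_antisym by blast
    qed
    then have "flag H (N # Ns) (\<pp> # \<pp>s)" using f N(1) HN ass by simp
    then show ?thesis by blast
  qed
qed

section \<open>Translation of flags into indexed sequences\<close>

lemma flag_iff:
  assumes "submodule H R M"
  shows "flag H Ns \<pp>s \<longleftrightarrow>
      length Ns = length \<pp>s \<and>
      (\<forall>N\<in>set Ns. submodule N R M) \<and>
      (H # Ns) ! length \<pp>s = carrier M \<and>
      (\<forall>i<length \<pp>s. (H # Ns) ! i \<subset> Ns ! i) \<and>
      set \<pp>s \<subseteq> Spec R \<and>
      sorted_wrt (\<lambda>\<pp> \<qq>. (\<qq>, \<pp>) \<in> le \<and> \<qq> \<noteq> \<pp>) \<pp>s \<and>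
      (\<forall>i<length \<pp>s. coprimary R (\<pp>s ! i) (subquotient M (Ns ! i) ((H # Ns) ! i)))"
  using assms
proof (induction H Ns \<pp>s rule: flag.induct)
  case (2 H N Ns \<pp> \<pp>s)
  show ?case
  proof (cases "submodule N R M \<and> H \<subset> N")
    case True
    then have "coprimary R \<pp> (subquotient M N H) \<longleftrightarrow> \<pp> \<in> Spec R \<and> Ass_over N H = {\<pp>}"
      unfolding coprimary_def using Ass_subquotient[of N H] 2(2) by auto
    \<comment> \<open>This recovers the condition \<open>set \<pp>s \<subseteq> Spec R\<close> from
      the recursive definition.\<close>
    moreover have "Ass_over N H = {\<pp>} \<Longrightarrow> \<pp> \<in> Spec R" using Ass_over_Spec by blast
    \<comment> \<open>Splitting off index 0 by \<open>All_less_Suc2\<close> matches the recursion of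
      \<open>flag\<close>; the remaining indices shift by one and the base becomes
      \<open>N\<close>.\<close>
    ultimately show ?thesis
      using 2(1) True by (auto simp: All_less_Suc2)
  qed (auto simp: All_less_Suc2)
qed auto

end

text \<open>Passes from steps numbered from 1 to list positions numbered from 0; the subtraction
  never truncates, as \<open>i\<close> is at least 1.\<close>

lemma ball_atLeastAtMost_pred_iff:
  "(\<forall>i\<in>{1..n}. P (i - 1) i) \<longleftrightarrow> (\<forall>i<n. P i (Suc i))"
proof
  assume "\<forall>i<n. P i (Suc i)"
  moreover have "i - 1 < n \<and> i = Suc (i - 1)" if "i \<in> {1..n}" for i :: nat using that by auto
  ultimately show "\<forall>i\<in>{1..n}. P (i - 1) i" by metis
qed force

theorem theorem1p2:
  fixes R :: "('a, 'r) ring_scheme"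
    and M :: "('a, 'b, 'm) module_scheme"
    and le :: "'a set rel"
  assumes "cring R"
    and "noetherian_ring R"
    and "module R M"
    and "carrier M \<noteq> {\<zero>\<^bsub>M\<^esub>}"
    and "finite_type R M"
    and "linear_order_on (Spec R) le"
    and "\<And>\<pp> \<qq>. \<pp> \<in> Spec R \<Longrightarrow> \<qq> \<in> Spec R \<Longrightarrow> \<pp> \<subseteq> \<qq> \<Longrightarrow> (\<pp>, \<qq>) \<in> le"
  shows "\<exists>!F. case F of (Ms, ps) \<Rightarrow>
      length Ms = length ps + 1 \<and>
      (\<forall>H \<in> set Ms. submodule H R M) \<and>
      Ms ! 0 = {\<zero>\<^bsub>M\<^esub>} \<and>
      Ms ! length ps = carrier M \<and>
      (\<forall>i \<in> {1..length ps}. Ms ! (i - 1) \<subset> Ms ! i) \<and>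
      set ps \<subseteq> Spec R \<and>
      sorted_wrt (\<lambda>\<pp> \<qq>. (\<qq>, \<pp>) \<in> le \<and> \<qq> \<noteq> \<pp>) ps \<and>
      (\<forall>i \<in> {1..length ps}.
         coprimary R (ps ! (i - 1)) (subquotient M (Ms ! i) (Ms ! (i - 1))))"
    (is "\<exists>!F. ?P F")
proof -
  interpret finite_type_module_ordered_Spec R M le
    using assms
    by (intro finite_type_module_ordered_Spec.intro finite_type_module.intro
        finite_type_module_axioms.intro finite_type_module_ordered_Spec_axioms.intro)
  let ?Z = "{\<zero>\<^bsub>M\<^esub>}"
  note Z = submodule_singleton_zero
  have P_flag: "?P (?Z # Ns, ps) \<longleftrightarrow> flag ?Z Ns ps" for Ns ps
    unfolding flag_iff[OF Z]
      ball_atLeastAtMost_pred_iff[of "length ps" "\<lambda>j i. (?Z # Ns) ! j \<subset> (?Z # Ns) ! i"]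
      ball_atLeastAtMost_pred_iff[of "length ps"
        "\<lambda>j i. coprimary R (ps ! j) (subquotient M ((?Z # Ns) ! i) ((?Z # Ns) ! j))"]
      prod.case
    using Z by auto
  obtain Ns \<pp>s where f: "flag ?Z Ns \<pp>s" using flag_exists[OF Z] by blast
  show ?thesis
  proof (rule ex1I[of _ "(?Z # Ns, \<pp>s)"])
    show "?P (?Z # Ns, \<pp>s)" using P_flag f by blast
    fix F assume F: "?P F"
    obtain Ms ps where Fe: "F = (Ms, ps)" by force
    \<comment> \<open>The length condition excludes the empty list, and \<open>Ms ! 0\<close> fixes
      the head as the zero submodule.\<close>
    with F obtain Ns' where Ms: "Ms = ?Z # Ns'" by (cases Ms) auto
    have "flag ?Z Ns' ps" using F P_flag unfolding Fe Ms by blast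
    then show "F = (?Z # Ns, \<pp>s)" using flag_unique[OF f _ Z] Fe Ms by blast
  qed
qed

end
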